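(* Let $G$ be a connected graph with a bridge $e=\{v_1,v_2\}$, and let $G_1$ and $G_2$ be the connected components of $G\setminus e$, with $v_1\in V(G_1)$ and $v_2\in V(G_2)$. Then $$\kappa(G)=\kappa(G_1)+\kappa(G_2)+\frac{m_{G_2}+1}{m_G}\alpha_{G_1}(v_1)+\frac{m_{G_1}+1}{m_G}\alpha_{G_2}(v_2)+\frac{(2m_{G_1}+1)(2m_{G_2}+1)}{2m_G}.$$
   Context: All graphs are finite, simple and undirected. For a graph $H$, $m_H$ is the number of edges. $G\setminus e$ is the graph obtained from $G$ by removing the edge $e$; $e$ is a bridge of the connected graph $G$ if $G\setminus e$ is disconnected. For a connected graph $H$, consider the simple random walk on $H$ (from a vertex, move to a uniformly random neighbour), with stationary distribution $\pi_j=\deg_H(j)/(2m_H)$ and mean first passage times $m_{i,j}$ from $i$ to $j$ ($i\neq j$). Kemeny's constant is $\kappa(H)=\sum_{j\neq i}\pi_jm_{i,j}$, which does not depend on the choice of the vertex $i$. The accessibility index of a vertex $v$ in $H$ is $\alpha_H(v)=\sum_{i\neq v}\pi_im_{i,v}$. For a single-vertex graph both are $0$ (empty sums). *)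

theory Defs
  imports "HOL-Probability.Probability"
begin

text \<open>An undirected edge between \<open>u\<close> and \<open>v\<close> is the two-element set \<open>{u, v}\<close>.\<close>

record 'a ugraph =
  verts :: "'a set"
  edges :: "'a set set"

definition simple_graph :: "'a ugraph \<Rightarrow> bool" where
  "simple_graph G \<longleftrightarrow> finite (verts G) \<and> (\<forall>e\<in>edges G. e \<subseteq> verts G \<and> card e = 2)"

definition num_edges :: "'a ugraph \<Rightarrow> nat" where
  "num_edges G = card (edges G)"

definition neighbours :: "'a ugraph \<Rightarrow> 'a \<Rightarrow> 'a set" where
  "neighbours G v = {u. {v, u} \<in> edges G}"

definition degree :: "'a ugraph \<Rightarrow> 'a \<Rightarrow> nat" where
  "degree G v = card (neighbours G v)"

definition reachable :: "'a ugraph \<Rightarrow> 'a \<Rightarrow> 'a \<Rightarrow> bool" where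
  "reachable G u v \<longleftrightarrow> (u, v) \<in> {(x, y). {x, y} \<in> edges G}\<^sup>*"

definition connected_graph :: "'a ugraph \<Rightarrow> bool" where
  "connected_graph G \<longleftrightarrow> verts G \<noteq> {} \<and> (\<forall>u\<in>verts G. \<forall>v\<in>verts G. reachable G u v)"

definition induced_subgraph :: "'a ugraph \<Rightarrow> 'a set \<Rightarrow> 'a ugraph" where
  "induced_subgraph G W = \<lparr>verts = W, edges = {e \<in> edges G. e \<subseteq> W}\<rparr>"

definition graph_components :: "'a ugraph \<Rightarrow> 'a ugraph set" where
  "graph_components G = (\<lambda>v. induced_subgraph G {u \<in> verts G. reachable G v u}) ` verts G"

definition delete_edge :: "'a ugraph \<Rightarrow> 'a set \<Rightarrow> 'a ugraph" where
  "delete_edge G e = \<lparr>verts = verts G, edges = edges G - {e}\<rparr>"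

definition bridge :: "'a ugraph \<Rightarrow> 'a set \<Rightarrow> bool" where
  "bridge G e \<longleftrightarrow> e \<in> edges G \<and> \<not> connected_graph (delete_edge G e)"

text \<open>
  The law of the trajectory \<open>[X 0, \<dots>, X n]\<close> of the simple random walk started at \<open>X 0 = v\<close>.
  It is meaningful only if the walk cannot get stuck at an isolated vertex.
\<close>

primrec random_walk :: "'a ugraph \<Rightarrow> nat \<Rightarrow> 'a \<Rightarrow> 'a list pmf" where
  "random_walk G 0 v = return_pmf [v]"
| "random_walk G (Suc n) v =
     bind_pmf (pmf_of_set (neighbours G v)) (\<lambda>w. map_pmf (\<lambda>xs. v # xs) (random_walk G n w))"

text \<open>
  The probability that the first time \<open>n \<ge> 1\<close> at which the walk started at \<open>i\<close> visits \<open>j\<close>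
  equals \<open>n\<close>. This event is determined by the first \<open>n\<close> steps.
\<close>

definition first_passage_prob :: "'a ugraph \<Rightarrow> 'a \<Rightarrow> 'a \<Rightarrow> nat \<Rightarrow> real" where
  "first_passage_prob G i j n =
     measure_pmf.prob (random_walk G n i) {xs. n \<ge> 1 \<and> xs ! n = j \<and> (\<forall>k\<in>{1..<n}. xs ! k \<noteq> j)}"

text \<open>
  The expectation of the first passage time, which is almost surely finite with finite mean
  when \<open>G\<close> is finite and connected and \<open>i \<noteq> j\<close>. Only this case is used.
\<close>

definition mean_first_passage :: "'a ugraph \<Rightarrow> 'a \<Rightarrow> 'a \<Rightarrow> real" where
  "mean_first_passage G i j = (\<Sum>n. real n * first_passage_prob G i j n)"

definition stationary :: "'a ugraph \<Rightarrow> 'a \<Rightarrow> real" where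
  "stationary G j = real (degree G j) / (2 * real (num_edges G))"

text \<open>
  Kemeny's constant is the common value, over all starting vertices \<open>i\<close>, of the sum below;
  for a finite connected graph the sum does not depend on \<open>i\<close>.
\<close>

definition kemeny :: "'a ugraph \<Rightarrow> real" where
  "kemeny G = (THE c. \<forall>i\<in>verts G.
     c = (\<Sum>j\<in>verts G - {i}. stationary G j * mean_first_passage G i j))"

definition accessibility_index :: "'a ugraph \<Rightarrow> 'a \<Rightarrow> real" where
  "accessibility_index G v =
     (\<Sum>i\<in>verts G - {v}. stationary G i * mean_first_passage G i v)"

end

theory Submission
  imports Defs
begin

text \<open>
  For a fixed target \<open>j\<close>, the hitting times \<open>h(i, j)\<close> form the only solution of the first-step
  equations \<open>h(j, j) = 0\<close> and \<open>deg i * h(i, j) = deg i + (\<Sum>w. h(w, j))\<close>, where \<open>i \<noteq> j\<close> and \<open>w\<close> runs over the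
  neighbours of \<open>i\<close>, because harmonic functions on a connected graph are constant.
  Let the bridge join \<open>a\<close> in \<open>A\<close> to \<open>b\<close> in \<open>B\<close>, and let \<open>h\<close> be the hitting times of \<open>A\<close>.
  For a target \<open>j\<close> in \<open>A\<close>, the hitting times of \<open>G\<close> from \<open>i\<close> in \<open>A\<close> are
  \<open>h(i, j) + (m_B + 1) / m_A * (h(i, j) + h(j, a) - h(i, a))\<close>, where the correction accounts for
  the excursions into \<open>B\<close>, and crossing from \<open>b\<close> to \<open>a\<close> takes \<open>2 * m_B + 1\<close> steps on average.
  Evaluating Kemeny's constant from the starting vertex \<open>a\<close> gives the formula.
\<close>

subsection \<open>Harmonic functions on a connected graph\<close>

locale connected_simple_graph =
  fixes G :: "'a ugraph"
  assumes simple: "simple_graph G" and conn: "connected_graph G"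
begin

lemma finite_verts: "finite (verts G)"
  using simple by (simp add: simple_graph_def)

lemma finite_edges: "finite (edges G)"
  by (rule finite_subset[of _ "Pow (verts G)"])
    (use simple finite_verts in \<open>auto simp: simple_graph_def\<close>)

lemma neighbours_subset: "neighbours G i \<subseteq> verts G"
  using simple by (auto simp: simple_graph_def neighbours_def)

lemma finite_neighbours: "finite (neighbours G i)"
  using finite_subset[OF neighbours_subset finite_verts] .

lemma neighbours_commute: "i \<in> neighbours G j \<longleftrightarrow> j \<in> neighbours G i"
  by (simp add: neighbours_def insert_commute)

lemma degree_pos:
  assumes "i \<in> verts G" "j \<in> verts G" "i \<noteq> j"
  shows "degree G i > 0"
proof -
  have "(i, j) \<in> {(x, y). {x, y} \<in> edges G}\<^sup>*"
    using conn assms by (auto simp: connected_graph_def reachable_def)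
  then obtain w where "{i, w} \<in> edges G"
    using assms(3) by (auto elim: converse_rtranclE)
  hence "neighbours G i \<noteq> {}" by (auto simp: neighbours_def)
  thus ?thesis by (simp add: degree_def card_gt_0_iff finite_neighbours)
qed

text \<open>Each value \<open>f w\<close> occurs once for every neighbour of \<open>w\<close>. In
  probabilistic terms, the degrees form an invariant measure of the walk.\<close>

lemma sum_degree_mult: 
  "(\<Sum>i\<in>verts G. real (degree G i) * f i) = (\<Sum>i\<in>verts G. \<Sum>w\<in>neighbours G i. f w)"
proof -
  have N: "neighbours G i = {w \<in> verts G. w \<in> neighbours G i}" for i
    using neighbours_subset by auto
  have "(\<Sum>i\<in>verts G. \<Sum>w\<in>neighbours G i. f w)
      = (\<Sum>i\<in>verts G. \<Sum>w\<in>{w \<in> verts G. w \<in> neighbours G i}. f w)"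
    using N by simp
  also have "\<dots> = (\<Sum>w\<in>verts G. \<Sum>i\<in>{i \<in> verts G. w \<in> neighbours G i}. f w)"
    by (rule sum.swap_restrict) (rule finite_verts)+
  also have "\<dots> = (\<Sum>w\<in>verts G. real (degree G w) * f w)"
  proof (rule sum.cong)
    fix w
    have "{i \<in> verts G. w \<in> neighbours G i} = neighbours G w"
      using N[of w] neighbours_commute by blast
    thus "(\<Sum>i\<in>{i \<in> verts G. w \<in> neighbours G i}. f w) = real (degree G w) * f w"
      by (simp add: degree_def)
  qed simp
  finally show ?thesis by simp
qed

lemma handshake: "(\<Sum>i\<in>verts G. real (degree G i)) = 2 * real (num_edges G)"
proof -
  have "degree G v = card {e \<in> edges G. v \<in> e}" for v
    unfolding degree_def
  proof (rule bij_betw_same_card[of "\<lambda>u. {v, u}"], unfold bij_betw_def, intro conjI)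
    show "inj_on (\<lambda>u. {v, u}) (neighbours G v)"
      by (auto simp: inj_on_def doubleton_eq_iff)
    show "(\<lambda>u. {v, u}) ` neighbours G v = {e \<in> edges G. v \<in> e}"
    proof (intro equalityI subsetI)
      fix e assume "e \<in> {e \<in> edges G. v \<in> e}"
      moreover from this have "card e = 2" using simple by (auto simp: simple_graph_def)
      ultimately show "e \<in> (\<lambda>u. {v, u}) ` neighbours G v"
        by (auto simp: card_2_iff neighbours_def insert_commute)
    qed (auto simp: neighbours_def)
  qed
  hence "(\<Sum>v\<in>verts G. degree G v) = (\<Sum>v\<in>verts G. \<Sum>e\<in>{e \<in> edges G. v \<in> e}. 1)"
    by simp
  also have "\<dots> = (\<Sum>e\<in>edges G. \<Sum>v\<in>{v \<in> verts G. v \<in> e}. 1)"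
    by (rule sum.swap_restrict) (rule finite_verts finite_edges)+
  also have "\<dots> = (\<Sum>e\<in>edges G. 2)"
  proof (rule sum.cong)
    fix e assume "e \<in> edges G"
    hence "{v \<in> verts G. v \<in> e} = e" "card e = 2"
      using simple by (auto simp: simple_graph_def)
    thus "(\<Sum>v\<in>{v \<in> verts G. v \<in> e}. 1) = (2::nat)" by simp
  qed simp
  finally have "(\<Sum>v\<in>verts G. degree G v) = 2 * num_edges G"
    by (simp add: num_edges_def)
  thus ?thesis by (metis of_nat_mult of_nat_numeral of_nat_sum)
qed

text \<open>Harmonicity at a maximum point other than \<open>j\<close> forces every neighbour to be
  a maximum point too, so a path from a maximum point to \<open>j\<close> carries the maximum to
  \<open>j\<close>.\<close>

lemma maximum_principle:
  fixes u :: "'a \<Rightarrow> real"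
  assumes harmonic: "\<And>i. i \<in> verts G \<Longrightarrow> i \<noteq> j \<Longrightarrow>
      real (degree G i) * u i = (\<Sum>w\<in>neighbours G i. u w)"
    and j: "j \<in> verts G" and i: "i \<in> verts G"
  shows "u i \<le> u j"
proof -
  define m where "m = Max (u ` verts G)"
  have le: "u x \<le> m" if "x \<in> verts G" for x
    using that finite_verts by (simp add: m_def)
  have "m \<in> u ` verts G"
    unfolding m_def using finite_verts i by (intro Max_in) auto
  then obtain a where a: "a \<in> verts G" "u a = m" by auto
  \<comment> \<open>The alternative \<open>u j = m\<close> covers paths that meet \<open>j\<close>
    on the way, where \<open>u\<close> need not be harmonic.\<close>
  have path: "u j = m \<or> (y \<in> verts G \<and> u y = m)"
    if "(a, y) \<in> {(x, y). {x, y} \<in> edges G}\<^sup>*" for y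
    using that
  proof (induction rule: rtrancl_induct)
    case base
    then show ?case using a by simp
  next
    case (step x y)
    show ?case
    proof (cases "u j = m")
      case False
      with step have x: "x \<in> verts G" "u x = m" "x \<noteq> j" by auto
      have y: "y \<in> neighbours G x" using step by (simp add: neighbours_def)
      have "(\<Sum>w\<in>neighbours G x. m - u w) = 0"
        using harmonic[of x] x by (simp add: sum_subtractf degree_def)
      hence "m - u y = 0"
        using y le neighbours_subset[of x]
        by (subst (asm) sum_nonneg_eq_0_iff) (auto simp: finite_neighbours)
      thus ?thesis using y neighbours_subset[of x] by auto
    qed simp
  qed
  have "u j = m"
    using path[of j] conn a j by (auto simp: connected_graph_def reachable_def)
  thus ?thesis using le i by auto
qed

text \<open>The maximum principle applies to \<open>u\<close> and to \<open>- u\<close>.\<close>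

lemma harmonic_constant:
  fixes u :: "'a \<Rightarrow> real"
  assumes "\<And>i. i \<in> verts G \<Longrightarrow> i \<noteq> j \<Longrightarrow>
      real (degree G i) * u i = (\<Sum>w\<in>neighbours G i. u w)"
    and "j \<in> verts G" "i \<in> verts G"
  shows "u i = u j"
  using maximum_principle[of j u i] maximum_principle[of j "\<lambda>x. - u x" i] assms
  by (simp add: sum_negf)

end

subsection \<open>First passage times\<close>

lemma hd_random_walk: "xs \<in> set_pmf (random_walk G n i) \<Longrightarrow> xs ! 0 = i"
  by (cases n) auto

lemma measure_bind_pmf:
  "measure_pmf.prob (bind_pmf M f) X = (\<integral>x. measure_pmf.prob (f x) X \<partial>measure_pmf M)"
  unfolding measure_pmf_bind
  by (rule measure_pmf.measure_bind[where N = "count_space UNIV"]) (auto simp: measure_pmf_in_subprob_algebra)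

text \<open>Conditioning on the first step \<open>w\<close>. The case \<open>w = j\<close> is
  separate because the walk has then already arrived, whereas
  \<open>first_passage_prob G j j\<close> counts returns to \<open>j\<close>.\<close>

lemma (in connected_simple_graph) first_passage_prob_Suc:
  assumes "degree G i > 0"
  shows "real (degree G i) * first_passage_prob G i j (Suc n)
       = (\<Sum>w\<in>neighbours G i. if w = j then of_bool (n = 0) else first_passage_prob G w j n)"
proof -
  have N: "neighbours G i \<noteq> {}" "finite (neighbours G i)"
    using assms finite_neighbours by (auto simp: degree_def)
  \<comment> \<open>For the walk that remains after the first step, a visit at time 0 counts as
    well, so \<open>k\<close> starts at 0 here.\<close>
  let ?A = "{xs. xs ! n = j \<and> (\<forall>k<n. xs ! k \<noteq> j)}"
  have vim: "(#) i -` {xs. Suc n \<ge> 1 \<and> xs ! Suc n = j \<and> (\<forall>k\<in>{1..<Suc n}. xs ! k \<noteq> j)} = ?A"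
  proof -
    have "(\<forall>k\<in>{1..<Suc n}. (i # xs) ! k \<noteq> j) \<longleftrightarrow> (\<forall>k<n. xs ! k \<noteq> j)" for xs
    proof -
      have *: "{1..<Suc n} = Suc ` {..<n}"
        by (metis One_nat_def image_Suc_lessThan atLeastLessThanSuc_atLeastAtMost)
      show ?thesis unfolding * by auto
    qed
    thus ?thesis by auto
  qed
  have step: "measure_pmf.prob (random_walk G n w) ?A
      = (if w = j then of_bool (n = 0) else first_passage_prob G w j n)" for w
  proof (cases "n = 0")
    case True
    then show ?thesis by (simp add: first_passage_prob_def indicator_def)
  next
    case False
    have "?A \<inter> set_pmf (random_walk G n w) = (if w = j then {} else
        {xs. n \<ge> 1 \<and> xs ! n = j \<and> (\<forall>k\<in>{1..<n}. xs ! k \<noteq> j)} \<inter> set_pmf (random_walk G n w))"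
    proof -
      have "(\<forall>k<n. xs ! k \<noteq> j) \<longleftrightarrow> w \<noteq> j \<and> (\<forall>k\<in>{1..<n}. xs ! k \<noteq> j)"
        if "xs \<in> set_pmf (random_walk G n w)" for xs
        using hd_random_walk[OF that] False
        by (metis (no_types, lifting) atLeastLessThan_iff less_one linorder_not_le neq0_conv)
      thus ?thesis using False by auto
    qed
    thus ?thesis
      using False measure_Int_set_pmf[of "random_walk G n w" ?A] measure_Int_set_pmf[of "random_walk G n w"
          "{xs. n \<ge> 1 \<and> xs ! n = j \<and> (\<forall>k\<in>{1..<n}. xs ! k \<noteq> j)}"]
      by (cases "w = j") (simp_all add: first_passage_prob_def)
  qed
  have "first_passage_prob G i j (Suc n) = (\<Sum>w\<in>neighbours G i.
      if w = j then of_bool (n = 0) else first_passage_prob G w j n) / real (degree G i)"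
    unfolding first_passage_prob_def[of G i j "Suc n"] random_walk.simps measure_bind_pmf
      measure_map_pmf vim step degree_def
    using N by (rule integral_pmf_of_set)
  thus ?thesis using assms by simp
qed


text \<open>The value 1 at \<open>i = j\<close> says that the target is hit at time 0; with it the
  first-step recursion has the same form for every neighbour.\<close>

definition passage_cdf :: "'a ugraph \<Rightarrow> 'a \<Rightarrow> nat \<Rightarrow> 'a \<Rightarrow> real" where
  "passage_cdf G j n i = (if i = j then 1 else \<Sum>k\<le>n. first_passage_prob G i j k)"

text \<open>The expectation of the hitting time restricted to the event that it is at most
  \<open>n\<close>.\<close>

definition truncated_mean :: "'a ugraph \<Rightarrow> 'a \<Rightarrow> nat \<Rightarrow> 'a \<Rightarrow> real" where
  "truncated_mean G j n i = (if i = j then 0 else \<Sum>k\<le>n. real k * first_passage_prob G i j k)"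

text \<open>\<open>mean_first_passage G j j\<close> would concern returns to \<open>j\<close>; the
  first-step equations require the value 0 at the target.\<close>

definition hitting_time :: "'a ugraph \<Rightarrow> 'a \<Rightarrow> 'a \<Rightarrow> real" where
  "hitting_time G i j = (if i = j then 0 else mean_first_passage G i j)"

lemma hitting_time_self [simp]: "hitting_time G i i = 0"
  by (simp add: hitting_time_def)

lemma first_passage_prob_0 [simp]: "first_passage_prob G i j 0 = 0"
  by (simp add: first_passage_prob_def)

lemma first_passage_prob_nonneg: "first_passage_prob G i j n \<ge> 0"
  by (simp add: first_passage_prob_def)

lemma passage_cdf_0: "passage_cdf G j 0 i = of_bool (i = j)"
  by (simp add: passage_cdf_def)

lemma passage_cdf_mono: "m \<le> n \<Longrightarrow> passage_cdf G j m i \<le> passage_cdf G j n i"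
  by (auto simp: passage_cdf_def first_passage_prob_nonneg intro!: sum_mono2)

section \<open>Almost sure passage and finiteness of the mean hitting times\<close>

context connected_simple_graph
begin

text \<open>Summing the one-step recursion over time; the first step uses up one unit, hence the
  shift from \<open>Suc n\<close> to \<open>n\<close>.\<close>

lemma passage_cdf_Suc:
  assumes "i \<in> verts G" "j \<in> verts G" "i \<noteq> j"
  shows "real (degree G i) * passage_cdf G j (Suc n) i = (\<Sum>w\<in>neighbours G i. passage_cdf G j n w)"
proof -
  have d: "degree G i > 0" using degree_pos assms .
  have "real (degree G i) * passage_cdf G j (Suc n) i
      = (\<Sum>k\<le>n. real (degree G i) * first_passage_prob G i j (Suc k))"
    using assms(3) by (simp add: passage_cdf_def sum.atMost_Suc_shift sum_distrib_left del: sum.atMost_Suc)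
  also have "\<dots> = (\<Sum>w\<in>neighbours G i. \<Sum>k\<le>n. if w = j then of_bool (k = 0) else first_passage_prob G w j k)"
    by (simp add: first_passage_prob_Suc[OF d] sum.swap[of _ "{..n}"])
  also have "\<dots> = (\<Sum>w\<in>neighbours G i. passage_cdf G j n w)"
    by (rule sum.cong) (auto simp: passage_cdf_def of_bool_def)
  finally show ?thesis .
qed

text \<open>Splitting the time \<open>Suc k\<close> as \<open>k + 1\<close>: the summands 1 collect
  the probability \<open>passage_cdf\<close>.\<close>

lemma truncated_mean_Suc:
  assumes "i \<in> verts G" "j \<in> verts G" "i \<noteq> j"
  shows "real (degree G i) * truncated_mean G j (Suc n) i
       = (\<Sum>w\<in>neighbours G i. truncated_mean G j n w + passage_cdf G j n w)"
proof -
  have d: "degree G i > 0" using degree_pos assms .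
  have "real (degree G i) * truncated_mean G j (Suc n) i
      = (\<Sum>k\<le>n. real (Suc k) * (real (degree G i) * first_passage_prob G i j (Suc k)))"
    using assms(3)
    by (simp add: truncated_mean_def sum.atMost_Suc_shift sum_distrib_left mult.left_commute
        del: sum.atMost_Suc of_nat_Suc)
  also have "\<dots> = (\<Sum>w\<in>neighbours G i. \<Sum>k\<le>n. real (Suc k) *
      (if w = j then of_bool (k = 0) else first_passage_prob G w j k))"
    by (simp only: first_passage_prob_Suc[OF d] sum_distrib_left sum.swap[of _ "{..n}"])
  also have "\<dots> = (\<Sum>w\<in>neighbours G i. truncated_mean G j n w + passage_cdf G j n w)"
  proof (rule sum.cong)
    fix w
    have "(\<Sum>k\<le>n. real (Suc k) * of_bool (k = 0)) = (\<Sum>k\<in>{0::nat}. 1)"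
      by (intro sum.mono_neutral_cong_right) auto
    thus "(\<Sum>k\<le>n. real (Suc k) * (if w = j then of_bool (k = 0) else first_passage_prob G w j k))
        = truncated_mean G j n w + passage_cdf G j n w"
      by (cases "w = j")
        (simp_all add: truncated_mean_def passage_cdf_def distrib_right sum.distrib add.commute)
  qed simp
  finally show ?thesis .
qed

lemma passage_cdf_le_1:
  assumes "j \<in> verts G" "i \<in> verts G"
  shows "passage_cdf G j n i \<le> 1"
  using assms(2)
proof (induction n arbitrary: i)
  case 0
  then show ?case by (simp add: passage_cdf_0)
next
  case (Suc n)
  show ?case
  proof (cases "i = j")
    case False
    have "(\<Sum>w\<in>neighbours G i. passage_cdf G j n w) \<le> (\<Sum>w\<in>neighbours G i. 1)"
      using Suc neighbours_subset by (intro sum_mono) blast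
    hence "real (degree G i) * passage_cdf G j (Suc n) i \<le> real (degree G i) * 1"
      using passage_cdf_Suc[OF Suc.prems assms(1) False] by (simp add: degree_def)
    thus ?thesis using degree_pos[OF Suc.prems assms(1) False] by simp
  qed (simp add: passage_cdf_def)
qed

text \<open>The distribution functions increase to a limit that is harmonic away from
  \<open>j\<close>, hence constant, and equal to 1 at \<open>j\<close>.\<close>

lemma passage_cdf_tendsto:
  assumes "j \<in> verts G" "i \<in> verts G"
  shows "(\<lambda>n. passage_cdf G j n i) \<longlonglongrightarrow> 1"
proof -
  define F where "F x = lim (\<lambda>n. passage_cdf G j n x)" for x
  have lim: "(\<lambda>n. passage_cdf G j n x) \<longlonglongrightarrow> F x" if "x \<in> verts G" for x
  proof -
    have "Bseq (\<lambda>n. passage_cdf G j n x)"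
    proof (rule BseqI'[of _ 1])
      fix n
      have "passage_cdf G j 0 x \<le> passage_cdf G j n x" by (rule passage_cdf_mono) simp
      thus "norm (passage_cdf G j n x) \<le> 1"
        using passage_cdf_le_1[OF assms(1) that, of n] by (simp add: passage_cdf_0 of_bool_def split: if_splits)
    qed
    moreover have "monoseq (\<lambda>n. passage_cdf G j n x)"
      by (auto simp: monoseq_def intro!: passage_cdf_mono)
    ultimately show ?thesis
      by (simp add: F_def Bseq_monoseq_convergent convergent_LIMSEQ_iff[symmetric])
  qed
  have "F i = F j"
  proof (rule harmonic_constant[OF _ assms])
    fix x assume x: "x \<in> verts G" "x \<noteq> j"
    have "(\<lambda>n. real (degree G x) * passage_cdf G j (Suc n) x) \<longlonglongrightarrow> real (degree G x) * F x"
      by (intro tendsto_mult_left LIMSEQ_Suc lim x)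
    moreover have "(\<lambda>n. \<Sum>w\<in>neighbours G x. passage_cdf G j n w) \<longlonglongrightarrow> (\<Sum>w\<in>neighbours G x. F w)"
      using neighbours_subset by (intro tendsto_sum lim) blast
    ultimately show "real (degree G x) * F x = (\<Sum>w\<in>neighbours G x. F w)"
      unfolding passage_cdf_Suc[OF x(1) assms(1) x(2)] by (rule LIMSEQ_unique)
  qed
  moreover have "F j = 1" by (simp add: F_def passage_cdf_def)
  ultimately show ?thesis using lim[OF assms(2)] by simp
qed

text \<open>
  By induction on the truncation, such a function bounds all truncated means, so that the mean
  hitting times are finite.
\<close>

lemma hitting_supersolution:
  assumes "j \<in> verts G"
  obtains f where "\<And>i. i \<in> verts G \<Longrightarrow> f i \<ge> (0::real)"
    and "\<And>i. i \<in> verts G \<Longrightarrow> i \<noteq> j \<Longrightarrow>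
      real (degree G i) + (\<Sum>w\<in>neighbours G i. f w) \<le> real (degree G i) * f i"
proof -
  have "\<forall>\<^sub>F n in sequentially. \<forall>i\<in>verts G. passage_cdf G j n i > 1 / 2"
    by (intro eventually_ball_finite finite_verts ballI order_tendstoD(1)[OF passage_cdf_tendsto[OF assms]]) auto
  then obtain N where N: "\<And>i. i \<in> verts G \<Longrightarrow> passage_cdf G j N i > 1 / 2"
    by (auto simp: eventually_sequentially)
  \<comment> \<open>The summand is the probability that \<open>j\<close> is not yet hit at time
    \<open>k\<close>, so \<open>f\<close> is twice the expectation of the minimum of the hitting
    time and \<open>N\<close>. The factor 2 compensates for the bound 1 / 2.\<close>
  define f where "f i = 2 * (\<Sum>k<N. 1 - passage_cdf G j k i)" for i
  show ?thesis
  proof (rule that[of f])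
    fix i assume i: "i \<in> verts G"
    show "f i \<ge> 0"
      unfolding f_def using passage_cdf_le_1[OF assms i] by (intro mult_nonneg_nonneg sum_nonneg) auto
    assume ij: "i \<noteq> j"
    have "(\<Sum>w\<in>neighbours G i. f w)
        = 2 * (\<Sum>k<N. \<Sum>w\<in>neighbours G i. 1 - passage_cdf G j k w)"
      unfolding f_def by (simp only: sum_distrib_left[symmetric] sum.swap[of _ "{..<N}"])
    also have "\<dots> = real (degree G i) * (2 * (\<Sum>k<N. 1 - passage_cdf G j (Suc k) i))"
      unfolding sum_subtractf passage_cdf_Suc[OF i assms ij, symmetric]
      by (simp add: sum_distrib_left[symmetric] right_diff_distrib degree_def)
    \<comment> \<open>Shifting \<open>k\<close> drops the term 1 at \<open>k = 0\<close> and adds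
      \<open>1 - passage_cdf G j N i\<close>; the net loss exceeds 1 / 2.\<close>
    also have "(\<Sum>k<N. 1 - passage_cdf G j (Suc k) i)
        = (\<Sum>k<N. 1 - passage_cdf G j k i) - passage_cdf G j N i"
      using sum.lessThan_Suc_shift[of "\<lambda>k. 1 - passage_cdf G j k i" N] ij
      by (simp add: passage_cdf_0)
    also have "2 * \<dots> \<le> f i - 1"
      using N[OF i] by (simp add: f_def)
    finally show "real (degree G i) + (\<Sum>w\<in>neighbours G i. f w) \<le> real (degree G i) * f i"
      by (simp add: mult_left_mono right_diff_distrib)
  qed
qed

text \<open>The partial sums increase and stay below the supersolution, so the series in
  \<open>mean_first_passage\<close> converges.\<close>

lemma truncated_mean_tendsto:
  assumes "j \<in> verts G" "i \<in> verts G"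
  shows "(\<lambda>n. truncated_mean G j n i) \<longlonglongrightarrow> hitting_time G i j"
proof -
  obtain f where f0: "\<And>i. i \<in> verts G \<Longrightarrow> f i \<ge> (0::real)"
    and f: "\<And>i. i \<in> verts G \<Longrightarrow> i \<noteq> j \<Longrightarrow>
      real (degree G i) + (\<Sum>w\<in>neighbours G i. f w) \<le> real (degree G i) * f i"
    using hitting_supersolution[OF assms(1)] by blast
  have le: "truncated_mean G j n x \<le> f x" if "x \<in> verts G" for n x
    using that
  proof (induction n arbitrary: x)
    case 0
    then show ?case using f0[of x] by (auto simp: truncated_mean_def)
  next
    case (Suc n)
    show ?case
    proof (cases "x = j")
      case False
      have "(\<Sum>w\<in>neighbours G x. truncated_mean G j n w + passage_cdf G j n w)
          \<le> (\<Sum>w\<in>neighbours G x. f w + 1)"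
        using Suc neighbours_subset passage_cdf_le_1[OF assms(1)]
        by (intro sum_mono add_mono) blast+
      also have "\<dots> \<le> real (degree G x) * f x"
        using f[OF Suc.prems False] by (simp add: sum.distrib degree_def)
      finally have "real (degree G x) * truncated_mean G j (Suc n) x \<le> real (degree G x) * f x"
        by (simp only: truncated_mean_Suc[OF Suc.prems assms(1) False])
      thus ?thesis using degree_pos[OF Suc.prems assms(1) False] by simp
    qed (use f0[of x] Suc.prems in \<open>auto simp: truncated_mean_def\<close>)
  qed
  show ?thesis
  proof (cases "i = j")
    case False
    have "summable (\<lambda>n. real n * first_passage_prob G i j n)"
    proof (rule summableI_nonneg_bounded)
      fix n
      have "(\<Sum>k<n. real k * first_passage_prob G i j k) \<le> truncated_mean G j n i"
        using False by (auto simp: truncated_mean_def first_passage_prob_nonneg intro!: sum_mono2)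
      thus "(\<Sum>k<n. real k * first_passage_prob G i j k) \<le> f i"
        using le[OF assms(2)] by (rule order_trans)
    qed (simp add: first_passage_prob_nonneg)
    from summable_LIMSEQ'[OF this] show ?thesis
      using False by (simp add: truncated_mean_def hitting_time_def mean_first_passage_def)
  qed (simp add: truncated_mean_def)
qed

section \<open>First-step equations and the mean return time\<close>

lemma hitting_time_step:
  assumes "i \<in> verts G" "j \<in> verts G" "i \<noteq> j"
  shows "real (degree G i) * hitting_time G i j
       = real (degree G i) + (\<Sum>w\<in>neighbours G i. hitting_time G w j)"
proof -
  have "(\<lambda>n. real (degree G i) * truncated_mean G j (Suc n) i) \<longlonglongrightarrow> real (degree G i) * hitting_time G i j"
    by (intro tendsto_mult_left LIMSEQ_Suc truncated_mean_tendsto assms)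
  \<comment> \<open>Since \<open>passage_cdf\<close> tends to 1, every neighbour contributes one
    full step.\<close>
  moreover have "(\<lambda>n. \<Sum>w\<in>neighbours G i. truncated_mean G j n w + passage_cdf G j n w)
      \<longlonglongrightarrow> (\<Sum>w\<in>neighbours G i. hitting_time G w j + 1)"
    using neighbours_subset assms(2)
    by (intro tendsto_sum tendsto_add truncated_mean_tendsto passage_cdf_tendsto) blast+
  ultimately have "real (degree G i) * hitting_time G i j = (\<Sum>w\<in>neighbours G i. hitting_time G w j + 1)"
    unfolding truncated_mean_Suc[OF assms] by (rule LIMSEQ_unique)
  thus ?thesis by (simp add: sum.distrib degree_def)
qed

text \<open>The difference of two solutions is harmonic away from \<open>j\<close>, hence constant,
  and it vanishes at \<open>j\<close>.\<close>

lemma hitting_time_unique: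
  assumes "j \<in> verts G" "i \<in> verts G"
    and "f j = 0"
    and "\<And>i. i \<in> verts G \<Longrightarrow> i \<noteq> j \<Longrightarrow>
      real (degree G i) * f i = real (degree G i) + (\<Sum>w\<in>neighbours G i. f w)"
  shows "hitting_time G i j = f i"
proof -
  have "f i - hitting_time G i j = f j - hitting_time G j j"
    by (rule harmonic_constant[OF _ assms(1,2)])
      (simp add: right_diff_distrib sum_subtractf assms hitting_time_step)
  thus ?thesis using assms(3) by simp
qed

text \<open>Kac's formula times \<open>degree G j\<close>. Sum the defects of the first-step
  equations over all vertices: the hitting times cancel by \<open>sum_degree_mult\<close>, leaving
  the sum of degrees, and only \<open>j\<close> contributes a defect.\<close>

lemma mean_return_time:
  assumes "j \<in> verts G"
  shows "real (degree G j) + (\<Sum>w\<in>neighbours G j. hitting_time G w j) = 2 * real (num_edges G)"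
proof -
  let ?h = "\<lambda>i. hitting_time G i j" and ?d = "\<lambda>i. real (degree G i)"
  have "(\<Sum>i\<in>verts G. ?d i + (\<Sum>w\<in>neighbours G i. ?h w) - ?d i * ?h i)
      = (\<Sum>i\<in>verts G. if i = j then ?d j + (\<Sum>w\<in>neighbours G j. ?h w) else 0)"
    by (rule sum.cong) (auto simp: hitting_time_step assms)
  thus ?thesis
    using assms finite_verts handshake
    by (simp add: sum.distrib sum_subtractf sum_degree_mult)
qed

section \<open>Kemeny's constant and the accessibility index through hitting times\<close>

text \<open>This omits the factor \<open>1 / (2 * m)\<close>, which would be junk on the single-vertex graph.\<close>

definition kemeny_from :: "'a \<Rightarrow> real" where
  "kemeny_from i = (\<Sum>j\<in>verts G. real (degree G j) * hitting_time G i j)"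

text \<open>At \<open>x\<close> each target \<open>j\<close> adds the defect
  \<open>degree G j * degree G x\<close>; for \<open>j = x\<close> the mean return time subtracts
  \<open>2 * num_edges G * degree G x\<close>. By the handshake identity the total is zero, so the
  sum is harmonic.\<close>

lemma kemeny_from_constant:
  assumes "i \<in> verts G" "k \<in> verts G"
  shows "kemeny_from i = kemeny_from k"
proof (rule harmonic_constant[OF _ assms(2,1)])
  fix x assume x: "x \<in> verts G"
  let ?d = "\<lambda>i. real (degree G i)" and ?h = "hitting_time G"
  have "?d x * kemeny_from x - (\<Sum>w\<in>neighbours G x. kemeny_from w)
      = (\<Sum>j\<in>verts G. ?d j * (?d x * ?h x j - (\<Sum>w\<in>neighbours G x. ?h w j)))"
    unfolding kemeny_from_def
    by (simp add: sum_distrib_left right_diff_distrib sum_subtractf sum.swap[of _ "neighbours G x"] mult.left_commute)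
  also have "\<dots> = (\<Sum>j\<in>verts G. ?d j * ?d x - (if j = x then ?d x * (2 * real (num_edges G)) else 0))"
  proof (rule sum.cong)
    fix j assume j: "j \<in> verts G"
    show "?d j * (?d x * ?h x j - (\<Sum>w\<in>neighbours G x. ?h w j))
        = ?d j * ?d x - (if j = x then ?d x * (2 * real (num_edges G)) else 0)"
      using hitting_time_step[OF x j] mean_return_time[OF x, symmetric]
      by (cases "j = x") (auto simp: algebra_simps)
  qed simp
  also have "\<dots> = 0"
    using x finite_verts handshake by (simp add: sum_subtractf sum_distrib_right[symmetric])
  finally show "?d x * kemeny_from x = (\<Sum>w\<in>neighbours G x. kemeny_from w)" by simp
qed

text \<open>Independence of the start gives a value that fits every vertex, and the vertex
  \<open>i\<close> forces its uniqueness, so the \<open>THE\<close> in \<open>kemeny\<close> is well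
  defined.\<close>

lemma kemeny_eq:
  assumes "i \<in> verts G"
  shows "kemeny G = kemeny_from i / (2 * real (num_edges G))"
proof -
  have eq: "(\<Sum>j\<in>verts G - {k}. stationary G j * mean_first_passage G k j)
      = kemeny_from i / (2 * real (num_edges G))" if k: "k \<in> verts G" for k
  proof -
    have "(\<Sum>j\<in>verts G - {k}. stationary G j * mean_first_passage G k j)
        = (\<Sum>j\<in>verts G. stationary G j * hitting_time G k j)"
      by (rule sum.mono_neutral_cong_left) (auto simp: finite_verts hitting_time_def)
    also have "\<dots> = kemeny_from k / (2 * real (num_edges G))"
      by (simp add: kemeny_from_def stationary_def sum_divide_distrib)
    finally show ?thesis using kemeny_from_constant[OF k assms] by simp
  qed
  show ?thesis
    unfolding kemeny_def by (rule the_equality) (use assms eq in auto)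
qed

lemma accessibility_index_eq:
  "accessibility_index G v
    = (\<Sum>j\<in>verts G. real (degree G j) * hitting_time G j v) / (2 * real (num_edges G))"
proof -
  have "accessibility_index G v = (\<Sum>j\<in>verts G. stationary G j * hitting_time G j v)"
    unfolding accessibility_index_def
    by (rule sum.mono_neutral_cong_left) (auto simp: finite_verts hitting_time_def)
  thus ?thesis by (simp add: stationary_def sum_divide_distrib)
qed

end


subsection \<open>Two connected graphs joined by a bridge\<close>

text \<open>Stated through neighbourhoods, so that the first-step equations of \<open>G\<close> can
  be compared with those of \<open>A\<close> and \<open>B\<close> vertex by vertex.\<close>

locale bridged = G: connected_simple_graph G + A: connected_simple_graph A + B: connected_simple_graph B
  for G A B :: "'a ugraph" +
  fixes a b :: 'a
  assumes a: "a \<in> verts A" and b: "b \<in> verts B"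
    and verts: "verts G = verts A \<union> verts B" and disjoint: "verts A \<inter> verts B = {}"
    and neighbours_A: "\<And>i. i \<in> verts A \<Longrightarrow> i \<noteq> a \<Longrightarrow> neighbours G i = neighbours A i"
    and neighbours_B: "\<And>i. i \<in> verts B \<Longrightarrow> i \<noteq> b \<Longrightarrow> neighbours G i = neighbours B i"
    and neighbours_a: "neighbours G a = insert b (neighbours A a)"
    and neighbours_b: "neighbours G b = insert a (neighbours B b)"
    and num_edges: "num_edges G = num_edges A + num_edges B + 1"
begin

text \<open>Symmetry makes every result about targets in \<open>A\<close> available for
  \<open>B\<close>.\<close>

lemma swapped: "bridged G B A b a"
  by unfold_locales
    (use a b verts disjoint neighbours_A neighbours_B neighbours_a neighbours_b num_edges in auto)

lemma b_notin: "b \<notin> neighbours A a"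
  using b disjoint A.neighbours_subset by blast

lemma degree_A: "i \<in> verts A \<Longrightarrow> degree G i = degree A i + of_bool (i = a)"
  using b_notin A.finite_neighbours by (auto simp: degree_def neighbours_A neighbours_a)

lemma sum_neighbours_A:
  "i \<in> verts A \<Longrightarrow> (\<Sum>w\<in>neighbours G i. f w) = (\<Sum>w\<in>neighbours A i. f w) + (if i = a then f b else (0::real))"
  using b_notin A.finite_neighbours by (auto simp: neighbours_A neighbours_a)

text \<open>
  As a function of \<open>i\<close>, the bracket in \<open>f\<close> is harmonic on \<open>A\<close> away from \<open>a\<close> and \<open>j\<close>, vanishes at \<open>j\<close>, and
  at \<open>a\<close> exceeds its neighbour average by the mean return time \<open>2 * m_A / deg a\<close>. Its coefficient
  is determined by the first-step equation of \<open>G\<close> at \<open>a\<close>. If \<open>m_A = 0\<close>, then \<open>i = j = a\<close> and the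
  bracket vanishes, so the junk value of the quotient is harmless.
\<close>

lemma hitting_time_into_A:
  fixes j :: 'a
  defines "f \<equiv> \<lambda>i. hitting_time A i j + (real (num_edges B) + 1) / real (num_edges A) *
      (hitting_time A i j + hitting_time A j a - hitting_time A i a)"
  assumes j: "j \<in> verts A" and i: "i \<in> verts G"
  shows "hitting_time G i j = (if i \<in> verts A then f i
      else hitting_time B i b + (2 * real (num_edges B) + 1) + f a)"
proof (rule G.hitting_time_unique)
  define c where "c = (real (num_edges B) + 1) / real (num_edges A)"
  have f_eq: "f i = hitting_time A i j + c *
      (hitting_time A i j + hitting_time A j a - hitting_time A i a)" for i
    by (simp add: f_def c_def)
  let ?F = "\<lambda>i. if i \<in> verts A then f i
      else hitting_time B i b + (2 * real (num_edges B) + 1) + f a"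
  interpret swap: bridged G B A b a by (rule swapped)
  show "j \<in> verts G" "i \<in> verts G" using i j verts by auto
  show "?F j = 0" using j by (simp add: f_eq)
  fix x assume x: "x \<in> verts G" "x \<noteq> j"
  have sum_F_A: "(\<Sum>w\<in>neighbours A y. ?F w) = (\<Sum>w\<in>neighbours A y. f w)" for y
    using A.neighbours_subset by (intro sum.cong) auto
  have sum_F_B: "(\<Sum>w\<in>neighbours B y. ?F w) = (\<Sum>w\<in>neighbours B y. hitting_time B w b)
      + real (degree B y) * ((2 * real (num_edges B) + 1) + f a)" for y
  proof -
    have "(\<Sum>w\<in>neighbours B y. ?F w)
        = (\<Sum>w\<in>neighbours B y. hitting_time B w b + ((2 * real (num_edges B) + 1) + f a))"
      using B.neighbours_subset disjoint by (intro sum.cong) auto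
    thus ?thesis by (simp add: sum.distrib degree_def distrib_left)
  qed
  have sum_f: "(\<Sum>w\<in>neighbours A x. f w) = (\<Sum>w\<in>neighbours A x. hitting_time A w j)
      + c * ((\<Sum>w\<in>neighbours A x. hitting_time A w j) + real (degree A x) * hitting_time A j a
             - (\<Sum>w\<in>neighbours A x. hitting_time A w a))"
    unfolding f_eq sum.distrib sum_subtractf sum_distrib_left[symmetric]
    by (simp add: degree_def)
  show "real (degree G x) * ?F x = real (degree G x) + (\<Sum>w\<in>neighbours G x. ?F w)"
  proof (cases "x \<in> verts A")
    case True
    note step = A.hitting_time_step[OF True j x(2)]
    show ?thesis
    proof (cases "x = a")
      case False
      \<comment> \<open>The terms \<open>degree A x\<close> in the first-step equations for the
        targets \<open>j\<close> and \<open>a\<close> cancel in the bracket.\<close>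
      have "real (degree A x) * f x = real (degree A x) + (\<Sum>w\<in>neighbours A x. f w)"
        unfolding sum_f using step A.hitting_time_step[OF True a False]
        by (simp add: f_eq distrib_left right_diff_distrib mult.left_commute[of "real (degree A x)" c])
      thus ?thesis
        using True False by (simp add: degree_A sum_neighbours_A sum_F_A)
    next
      case xa: True
      have "degree A a > 0" using A.degree_pos[OF a j] x xa by simp
      hence "num_edges A > 0"
        using A.finite_edges by (auto simp: degree_def num_edges_def neighbours_def card_gt_0_iff)
      \<comment> \<open>The bridge adds 1 to the degree of \<open>a\<close> and a neighbour
        \<open>b\<close> of value \<open>2 * m_B + 1 + f a\<close>, so the equation at
        \<open>a\<close> needs the excess \<open>2 * (m_B + 1)\<close> over that of
        \<open>A\<close>.\<close>
      hence c: "c * (2 * real (num_edges A)) = 2 * (real (num_edges B) + 1)" by (simp add: c_def)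
      have "real (degree A a) * f a - (\<Sum>w\<in>neighbours A a. f w)
          = real (degree A a) + c * (2 * real (num_edges A))"
        unfolding sum_f[unfolded xa] A.mean_return_time[OF a, symmetric]
        using step[unfolded xa]
        by (simp add: f_eq distrib_left right_diff_distrib mult.left_commute[of "real (degree A a)" c])
      moreover have "b \<notin> verts A" using b disjoint by auto
      ultimately show ?thesis
        using xa a unfolding c by (simp add: degree_A sum_neighbours_A sum_F_A algebra_simps)
    qed
  next
    case False
    hence xB: "x \<in> verts B" using x verts by auto
    show ?thesis
    proof (cases "x = b")
      case True
      \<comment> \<open>The crossing time exceeds the \<open>2 * m_B\<close> of the return time
        formula in \<open>B\<close> by 1, for the step over the bridge.\<close>
      then show ?thesis
        using False xB a B.mean_return_time[OF b]
        by (simp add: swap.degree_A swap.sum_neighbours_A sum_F_B algebra_simps)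
    next
      case xb: False
      then show ?thesis
        using False xB B.hitting_time_step[OF xB b xb]
        by (simp add: swap.degree_A swap.sum_neighbours_A sum_F_B algebra_simps)
    qed
  qed
qed

lemma hitting_time_across:
  assumes "j \<in> verts A"
  shows "hitting_time G b j = 2 * real (num_edges B) + 1 + hitting_time G a j"
  using hitting_time_into_A[OF assms, of a] hitting_time_into_A[OF assms, of b] a b verts disjoint
  by auto

text \<open>For the start \<open>a\<close> the bracket is the commute time
  \<open>h(a, j) + h(j, a)\<close>, whose two directions yield \<open>kemeny A\<close> and the
  accessibility index. If \<open>m_A > 0\<close>, the factor \<open>1 + ?c\<close> is
  \<open>m_G / m_A\<close>.\<close>

lemma kemeny_part:
  "(\<Sum>j\<in>verts A. real (degree G j) * hitting_time G a j)
    = 2 * real (num_edges G) * kemeny A + 2 * (real (num_edges B) + 1) * accessibility_index A a"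
proof -
  let ?c = "(real (num_edges B) + 1) / real (num_edges A)" and ?d = "\<lambda>i. real (degree A i)"
  have "(\<Sum>j\<in>verts A. real (degree G j) * hitting_time G a j)
      = (\<Sum>j\<in>verts A. ?d j * hitting_time G a j)"
    \<comment> \<open>The additional degree at \<open>a\<close> multiplies the hitting time
      0.\<close>
    by (rule sum.cong) (auto simp: degree_A)
  also have "\<dots> = (\<Sum>j\<in>verts A. (1 + ?c) * (?d j * hitting_time A a j) + ?c * (?d j * hitting_time A j a))"
    using hitting_time_into_A[of _ a] a verts
    by (intro sum.cong) (auto simp: algebra_simps add_divide_distrib)
  also have "\<dots> = (1 + ?c) * A.kemeny_from a + ?c * (\<Sum>j\<in>verts A. ?d j * hitting_time A j a)"
    by (simp only: sum.distrib sum_distrib_left[symmetric] A.kemeny_from_def)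
  also have "\<dots> = 2 * real (num_edges G) * kemeny A + 2 * (real (num_edges B) + 1) * accessibility_index A a"
  proof (cases "num_edges A = 0")
    \<comment> \<open>Without edges all degrees are 0, and both sides vanish, quotients by 0
      included.\<close>
    case True
    hence "degree A j = 0" for j
      using A.finite_edges by (auto simp: num_edges_def degree_def neighbours_def)
    thus ?thesis
      using True by (simp add: A.kemeny_from_def A.kemeny_eq[OF a] A.accessibility_index_eq)
  next
    case False
    thus ?thesis
      unfolding A.kemeny_eq[OF a] A.accessibility_index_eq num_edges
      by (simp add: field_simps)
  qed
  finally show ?thesis .
qed

text \<open>Start at \<open>a\<close> and split the targets. Those in \<open>B\<close> first cost a
  crossing of \<open>2 * m_A + 1\<close> steps, weighted by the total degree
  \<open>2 * m_B + 1\<close> of \<open>B\<close> in \<open>G\<close>; this gives the product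
  term.\<close>

lemma kemeny_bridged:
  "kemeny G = kemeny A + kemeny B
    + (real (num_edges B) + 1) / real (num_edges G) * accessibility_index A a
    + (real (num_edges A) + 1) / real (num_edges G) * accessibility_index B b
    + (2 * real (num_edges A) + 1) * (2 * real (num_edges B) + 1) / (2 * real (num_edges G))"
proof -
  interpret swap: bridged G B A b a by (rule swapped)
  let ?d = "\<lambda>i. real (degree G i)" and ?h = "hitting_time G"
  have "(\<Sum>j\<in>verts B. ?d j) = (\<Sum>j\<in>verts B. real (degree B j)) + (\<Sum>j\<in>verts B. of_bool (j = b))"
    by (simp add: swap.degree_A sum.distrib)
  also have "(\<Sum>j\<in>verts B. of_bool (j = b) :: real) = 1"
    using b B.finite_verts by (simp add: of_bool_def)
  finally have vol: "(\<Sum>j\<in>verts B. ?d j) = 2 * real (num_edges B) + 1"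
    by (simp add: B.handshake)
  have "G.kemeny_from a = (\<Sum>j\<in>verts A. ?d j * ?h a j) + (\<Sum>j\<in>verts B. ?d j * ?h a j)"
    unfolding G.kemeny_from_def verts
    by (rule sum.union_disjoint) (use A.finite_verts B.finite_verts disjoint in auto)
  also have "(\<Sum>j\<in>verts B. ?d j * ?h a j)
      = (\<Sum>j\<in>verts B. ?d j) * (2 * real (num_edges A) + 1) + (\<Sum>j\<in>verts B. ?d j * ?h b j)"
    by (simp add: swap.hitting_time_across distrib_left sum.distrib sum_distrib_right)
  finally have "G.kemeny_from a = 2 * real (num_edges G) * kemeny A
      + 2 * (real (num_edges B) + 1) * accessibility_index A a
      + (2 * real (num_edges B) + 1) * (2 * real (num_edges A) + 1)
      + (2 * real (num_edges G) * kemeny B + 2 * (real (num_edges A) + 1) * accessibility_index B b)"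
    unfolding vol kemeny_part swap.kemeny_part by simp
  moreover have "a \<in> verts G" "real (num_edges G) > 0" using a verts num_edges by auto
  ultimately show ?thesis
    by (simp only: G.kemeny_eq[of a]) (simp add: field_simps)
qed

end

subsection \<open>The components left by a bridge\<close>

lemma reachable_refl: "reachable G x x"
  by (simp add: reachable_def)

lemma reachable_trans: "reachable G x y \<Longrightarrow> reachable G y z \<Longrightarrow> reachable G x z"
  unfolding reachable_def by (rule rtrancl_trans)

lemma reachable_edge: "{x, y} \<in> edges G \<Longrightarrow> reachable G x y"
  unfolding reachable_def by auto

lemma reachable_sym: "reachable G x y \<Longrightarrow> reachable G y x"
proof -
  have "sym {(x, y). {x, y} \<in> edges G}" by (auto simp: sym_def insert_commute)
  thus "reachable G x y \<Longrightarrow> reachable G y x"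
    unfolding reachable_def by (metis sym_rtrancl symD)
qed

text \<open>Reachability is an equivalence relation, so any vertex of a component can represent
  it.\<close>

lemma component_eq:
  assumes "C \<in> graph_components D" "x \<in> verts C"
  shows "C = induced_subgraph D {u \<in> verts D. reachable D x u}"
proof -
  obtain v where C: "C = induced_subgraph D {u \<in> verts D. reachable D v u}"
    using assms(1) by (auto simp: graph_components_def)
  hence "reachable D v x" using assms(2) by (simp add: induced_subgraph_def)
  hence "reachable D v u \<longleftrightarrow> reachable D x u" for u
    using reachable_sym reachable_trans by metis
  thus ?thesis using C by simp
qed

lemma component_edge_closed:
  assumes "simple_graph D" "C \<in> graph_components D" "x \<in> verts C" "{x, y} \<in> edges D"
  shows "y \<in> verts C" "{x, y} \<in> edges C"
proof -
  note C = component_eq[OF assms(2,3)]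
  have "{x, y} \<subseteq> verts D" using assms(1,4) by (auto simp: simple_graph_def)
  moreover have "reachable D x y" by (rule reachable_edge) fact
  ultimately show "y \<in> verts C" "{x, y} \<in> edges C"
    using assms(4) by (subst C; auto simp: induced_subgraph_def reachable_refl)+
qed

lemma connected_simple_component:
  assumes "simple_graph D" "C \<in> graph_components D" "x \<in> verts C"
  shows "connected_simple_graph C"
proof
  note C = component_eq[OF assms(2,3)]
  show "simple_graph C"
    using assms(1) by (subst C) (auto simp: simple_graph_def induced_subgraph_def)
  \<comment> \<open>Membership in \<open>C\<close> is carried along the path, so that each next edge
    is again an edge of \<open>C\<close>.\<close>
  have from_x: "reachable C x u \<and> u \<in> verts C" if "reachable D x u" for u
    using that unfolding reachable_def
  proof (induction rule: rtrancl_induct)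
    case base
    then show ?case using assms(3) by simp
  next
    case (step y z)
    then show ?case
      using component_edge_closed[OF assms(1,2), of y z] by (auto intro: rtrancl_into_rtrancl)
  qed
  have "reachable C x u" if "u \<in> verts C" for u
    using from_x[of u] that by (subst (asm) (2) C) (simp add: induced_subgraph_def)
  thus "connected_graph C"
    unfolding connected_graph_def using assms(3) reachable_sym reachable_trans by (metis empty_iff)
qed

lemma neighbours_component:
  assumes "simple_graph D" "C \<in> graph_components D" "x \<in> verts C"
  shows "neighbours C x = neighbours D x"
  using component_edge_closed[OF assms]
  by (auto simp: neighbours_def) (subst (asm) component_eq[OF assms(2,3)], simp add: induced_subgraph_def)


lemma bridged_components:
  assumes simple: "simple_graph G" and conn: "connected_graph G"
    and bridge: "bridge G {a, b}"
    and A: "A \<in> graph_components (delete_edge G {a, b})" and a: "a \<in> verts A"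
    and B: "B \<in> graph_components (delete_edge G {a, b})" and b: "b \<in> verts B"
  shows "bridged G A B a b"
proof -
  define D where "D = delete_edge G {a, b}"
  note A = A[folded D_def] and B = B[folded D_def]
  have edges_D: "edges D = edges G - {{a, b}}" and verts_D: "verts D = verts G"
    by (simp_all add: D_def delete_edge_def)
  have D: "simple_graph D"
    using simple by (simp add: simple_graph_def edges_D verts_D)
  note eq_A = component_eq[OF A a] and eq_B = component_eq[OF B b]
  have verts_A: "verts A = {u \<in> verts G. reachable D a u}"
    and edges_A: "edges A = {f \<in> edges D. f \<subseteq> verts A}"
    by (subst eq_A; simp add: induced_subgraph_def verts_D)+
  have verts_B: "verts B = {u \<in> verts G. reachable D b u}"
    and edges_B: "edges B = {f \<in> edges D. f \<subseteq> verts B}"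
    by (subst eq_B; simp add: induced_subgraph_def verts_D)+
  have e: "{a, b} \<in> edges G" and "\<not> connected_graph D"
    using bridge by (simp_all add: bridge_def D_def)
  \<comment> \<open>Follow a path of \<open>G\<close> from \<open>a\<close>; each use of the bridge
    lands on \<open>a\<close> or \<open>b\<close>, where reachability in \<open>D\<close> starts
    afresh.\<close>
  have split: "reachable D a u \<or> reachable D b u" if "u \<in> verts G" for u
  proof -
    have "(a, u) \<in> {(x, y). {x, y} \<in> edges G}\<^sup>*"
      using conn that a verts_A by (auto simp: connected_graph_def reachable_def)
    thus ?thesis
    proof (induction rule: rtrancl_induct)
      case base
      then show ?case by (simp add: reachable_refl)
    next
      case (step y z)
      show ?case
      proof (cases "{y, z} = {a, b}")
        case True
        then show ?thesis by (auto simp: doubleton_eq_iff reachable_refl)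
      next
        case False
        hence "reachable D y z" using step by (intro reachable_edge) (simp add: edges_D)
        thus ?thesis using step reachable_trans by metis
      qed
    qed
  qed
  \<comment> \<open>Otherwise \<open>a\<close> would reach every vertex in \<open>D\<close>, against
    the bridge property.\<close>
  have sep: "\<not> reachable D a b"
  proof
    assume "reachable D a b"
    hence "reachable D a u" if "u \<in> verts G" for u
      using split[OF that] reachable_trans by metis
    hence "connected_graph D"
      unfolding connected_graph_def using a verts_A verts_D reachable_sym reachable_trans
      by (metis (no_types, lifting) empty_iff mem_Collect_eq)
    thus False using \<open>\<not> connected_graph D\<close> by contradiction
  qed
  have disjoint: "verts A \<inter> verts B = {}"
    using sep reachable_sym reachable_trans unfolding verts_A verts_B by fast
  have verts: "verts G = verts A \<union> verts B"
    using split by (auto simp: verts_A verts_B)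
  interpret G: connected_simple_graph G by (rule connected_simple_graph.intro[OF simple conn])
  interpret A: connected_simple_graph A by (rule connected_simple_component[OF D A a])
  interpret B: connected_simple_graph B by (rule connected_simple_component[OF D B b])
  have "edges G = insert {a, b} (edges A \<union> edges B)"
  proof (intro equalityI subsetI)
    fix f assume f: "f \<in> edges G"
    show "f \<in> insert {a, b} (edges A \<union> edges B)"
    proof (cases "f = {a, b}")
      case False
      obtain x y where xy: "f = {x, y}" "x \<in> verts G"
      proof -
        have "card f = 2" "f \<subseteq> verts G" using simple f by (auto simp: simple_graph_def)
        thus ?thesis using that by (auto simp: card_2_iff)
      qed
      have "f \<in> edges D" using f False by (simp add: edges_D)
      thus ?thesis
        using xy verts component_edge_closed(2)[OF D A, of x y] component_edge_closed(2)[OF D B, of x y]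
        by auto
    qed simp
  qed (use e in \<open>auto simp: edges_A edges_B edges_D\<close>)
  moreover have "{a, b} \<notin> edges A \<union> edges B"
    by (simp add: edges_A edges_B edges_D)
  moreover have "edges A \<inter> edges B = {}"
  proof -
    \<comment> \<open>Disjoint vertex sets still share the empty subset, which is no edge because
      edges have two elements.\<close>
    have "f = {}" if "f \<in> edges A" "f \<in> edges B" for f
      using that disjoint by (auto simp: edges_A edges_B)
    moreover have "{} \<notin> edges A"
    proof
      assume "{} \<in> edges A"
      hence "card ({} :: 'a set) = 2" using A.simple unfolding simple_graph_def by blast
      thus False by simp
    qed
    ultimately show ?thesis by blast
  qed
  ultimately have num: "num_edges G = num_edges A + num_edges B + 1"
    using A.finite_edges B.finite_edges by (simp add: num_edges_def card_Un_disjoint)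
  have nbrs: "neighbours G x = neighbours D x" if "x \<noteq> a" "x \<noteq> b" for x
    using that by (auto simp: neighbours_def edges_D doubleton_eq_iff)
  have "neighbours G x = neighbours A x" if "x \<in> verts A" "x \<noteq> a" for x
    using that nbrs[of x] neighbours_component[OF D A] b disjoint by auto
  moreover have "neighbours G x = neighbours B x" if "x \<in> verts B" "x \<noteq> b" for x
    using that nbrs[of x] neighbours_component[OF D B] a disjoint by auto
  moreover have "neighbours G a = insert b (neighbours D a)" "neighbours G b = insert a (neighbours D b)"
    using e by (auto simp: neighbours_def edges_D doubleton_eq_iff insert_commute)
  ultimately show ?thesis
    by unfold_locales
      (use a b verts disjoint num neighbours_component[OF D A a] neighbours_component[OF D B b] in simp_all)
qed

theorem theorem2p5:
  fixes G G1 G2 :: "'a ugraph" and e :: "'a set" and v1 v2 :: 'a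
  assumes "simple_graph G" and "connected_graph G"
    and "bridge G e" and "e = {v1, v2}"
    and "G1 \<in> graph_components (delete_edge G e)" and "G2 \<in> graph_components (delete_edge G e)"
    and "v1 \<in> verts G1" and "v2 \<in> verts G2"
  shows "kemeny G = kemeny G1 + kemeny G2
    + (real (num_edges G2) + 1) / real (num_edges G) * accessibility_index G1 v1
    + (real (num_edges G1) + 1) / real (num_edges G) * accessibility_index G2 v2
    + (2 * real (num_edges G1) + 1) * (2 * real (num_edges G2) + 1) / (2 * real (num_edges G))"
proof -
  interpret bridged G G1 G2 v1 v2
    using assms by (intro bridged_components) simp_all
  show ?thesis by (rule kemeny_bridged)
qed

end
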